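(* Let $p'\in\mathbb Z$, let $(p,q)$ be coprime integers with $q\ne0$, let $r\ge3$ be odd, and let $\check f_r(s,m,n,l)$ be the Fourier coefficients defined in the context. If $s,s'\in\{0,\dots,|q|-1\}$ and $m,m'\in\mathbb Z$ satisfy $\kappa(s,m)+\kappa(s',m')=0$, then for all $n,l\in\mathbb Z$ $$\check f_r(s,m,n,l)=\check f_r(s',m',n,l).$$ In particular $\check f_r(s^+,m^+,n,l)=\check f_r(s^-,m^-,n,l)$.
   Context: $\mathrm i=\sqrt{-1}$. Arithmetic data: choose integers with $p\tilde p+q\tilde q=1$ and $\begin{pmatrix}p&-\tilde q\\ q&\tilde p\end{pmatrix}=T^{a_k}S\cdots T^{a_1}S$, $S=\begin{pmatrix}0&-1\\ 1&0\end{pmatrix}$, $T=\begin{pmatrix}1&1\\ 0&1\end{pmatrix}$, $a_j\in\mathbb Z$; $C_j$ is the lower-left entry of $T^{a_j}S\cdots T^{a_1}S$, assumed nonzero for $1\le j\le k$ ($C_k=q$; $C_0=0$, and terms with factor $C_0$ are read as $0$). $K_j=\frac{(-1)^{j+1}\sum_{h=1}^ja_hC_h}{C_j}$. For $s\in\{0,\dots,|q|-1\}$: $I(s)=-C_{k-1}(2s+1+K_{k-1})$, $J(s)=\frac{2s+1}q+(-1)^k\sum_{j=1}^{k-1}\frac{(-1)^{j+1}K_j}{C_{j+1}}$, $K(s)=\frac{C_{k-1}(2s+1+K_{k-1})^2}q+\sum_{j=1}^{k-2}\frac{C_jK_j^2}{C_{j+1}}$. For $m\in\mathbb Z$: $\kappa(s,m)=\frac{I(s)}q+1-2m$.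 $(s^\pm,m^\pm)$ are the unique pairs with $\kappa(s^\pm,m^\pm)=\pm\frac1q$. Quantum dilogarithm: $\varphi_r(z)=\frac{4\pi\mathrm i}r\int_\Omega\frac{e^{(2z-\pi)x}}{4x\sinh(\pi x)\sinh(2\pi x/r)}dx$ for $-\frac\pi r<\mathrm{Re}\,z<\pi+\frac\pi r$, where $\Omega=(-\infty,-\eta]\cup\{|x|=\eta,\mathrm{Im}\,x\ge0\}\cup[\eta,\infty)$, $\eta\in(0,1)$, left to right. Regions: for $\epsilon\ge0$, $D_\epsilon=\{(x,y,z)\in\mathbb R^3: |x|<\frac\pi4-\epsilon,\ y-x>\epsilon,\ x+y>\epsilon,\ z-y>\epsilon,\ y+z<\pi-\epsilon,\ y+2z<\frac74\pi-\epsilon,\ 2z-y>\frac\pi4+\epsilon\}$. Fix a small $\epsilon>0$ and a $C^\infty$ function $\psi$ on $\mathbb R^3$ with $\psi=1$ on $\overline{D_\epsilon}$, $0<\psi<1$ on $D_{\epsilon/2}\setminus\overline{D_\epsilon}$, $\psi=0$ outside $D_{\epsilon/2}$, and $\psi(x,y,z)=\psi(-x,y,z)=\psi(x,y,\pi-z)$. Potential function: on $D_0$, $V_r(x,y,z,s,m,n,l)=\varphi_r(y+x+\frac\pi r)+\varphi_r(y-x+\frac\pi r)+\varphi_r(z-y)+\varphi_r(\pi-y-z)-\varphi_r(\pi-y-\frac\pi r)-\varphi_r(\frac\pi r)-\frac{p+2q}qx^2-4y^2-(4p'+2)z^2+2\pi\kappa(s,m)x-4\pi ny-2\pi(2l+1)z+K(s)\pi^2-\frac{\pi^2}3-\frac{4\pi}r(x+y)+\frac{2\pi^2}r-\frac{\pi^2}{3r^2}$.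 Fourier coefficients: $\check f_r(s,m,n,l)=4(-1)^{m+n+l}\big(\frac r{2\pi}\big)^3\int_{D_{\epsilon/2}}\psi(x,y,z)\sin\big(\tfrac xq-J(s)\pi\big)\sin(2z)\,e^{-\mathrm i(x+y)+\frac r{4\pi\mathrm i}V_r(x,y,z,s,m,n,l)}\,dx\,dy\,dz$. *)

theory Defs
  imports "HOL-Complex_Analysis.Complex_Analysis"
begin

no_notation fps_nth (infixl \<open>$\<close> 75)

section \<open>Arithmetic data\<close>

definition mat2 :: "int \<Rightarrow> int \<Rightarrow> int \<Rightarrow> int \<Rightarrow> int ^ 2 ^ 2" where
  "mat2 a b c d = vector [vector [a, b], vector [c, d]]"

definition S_mat :: "int ^ 2 ^ 2" where
  "S_mat = mat2 0 (-1) 1 0"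

definition T_mat :: "int ^ 2 ^ 2" where
  "T_mat = mat2 1 1 0 1"

definition T_zpow :: "int \<Rightarrow> int ^ 2 ^ 2" where
  "T_zpow n = (if 0 \<le> n then (((**) T_mat) ^^ nat n) (mat 1)
               else (((**) (matrix_inv T_mat)) ^^ nat (- n)) (mat 1))"

primrec TS_word :: "(nat \<Rightarrow> int) \<Rightarrow> nat \<Rightarrow> int ^ 2 ^ 2" where
  "TS_word a 0 = mat 1"
| "TS_word a (Suc j) = T_zpow (a (Suc j)) ** S_mat ** TS_word a j"

definition C_entry :: "(nat \<Rightarrow> int) \<Rightarrow> nat \<Rightarrow> int" where
  "C_entry a j = TS_word a j $ 2 $ 1"

text \<open>For \<open>j = 0\<close> one has \<open>C_entry a 0 = 0\<close> and \<open>K_entry a 0 = 0\<close>, the latter by the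
  convention \<open>x / 0 = 0\<close>. The value \<open>K_entry a 0\<close> is only used below (when \<open>k = 1\<close>) in products
  with \<open>C_entry a 0\<close>, which vanish as intended.\<close>

definition K_entry :: "(nat \<Rightarrow> int) \<Rightarrow> nat \<Rightarrow> real" where
  "K_entry a j =
     (-1) ^ (j + 1) * (\<Sum>h = 1..j. real_of_int (a h) * real_of_int (C_entry a h))
       / real_of_int (C_entry a j)"

definition I_fun :: "nat \<Rightarrow> (nat \<Rightarrow> int) \<Rightarrow> int \<Rightarrow> real" where
  "I_fun k a s =
     - real_of_int (C_entry a (k - 1)) * (2 * real_of_int s + 1 + K_entry a (k - 1))"

definition J_fun :: "int \<Rightarrow> nat \<Rightarrow> (nat \<Rightarrow> int) \<Rightarrow> int \<Rightarrow> real" where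
  "J_fun q k a s =
     (2 * real_of_int s + 1) / real_of_int q
     + (-1) ^ k * (\<Sum>j = 1..k - 1. (-1) ^ (j + 1) * K_entry a j / real_of_int (C_entry a (j + 1)))"

definition K_fun :: "int \<Rightarrow> nat \<Rightarrow> (nat \<Rightarrow> int) \<Rightarrow> int \<Rightarrow> real" where
  "K_fun q k a s =
     real_of_int (C_entry a (k - 1)) * (2 * real_of_int s + 1 + K_entry a (k - 1))\<^sup>2 / real_of_int q
     + (\<Sum>j = 1..k - 2. real_of_int (C_entry a j) * (K_entry a j)\<^sup>2 / real_of_int (C_entry a (j + 1)))"

definition kappa :: "int \<Rightarrow> nat \<Rightarrow> (nat \<Rightarrow> int) \<Rightarrow> int \<Rightarrow> int \<Rightarrow> real" where
  "kappa q k a s m = I_fun k a s / real_of_int q + 1 - 2 * real_of_int m"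

text \<open>The pairs \<open>(s\<^sup>+, m\<^sup>+)\<close> and \<open>(s\<^sup>-, m\<^sup>-)\<close> are obtained for \<open>\<sigma> = 1\<close> and \<open>\<sigma> = -1\<close>;
  existence and uniqueness are proved below in \<open>special_pair_ex1\<close>.\<close>

definition special_pair :: "int \<Rightarrow> nat \<Rightarrow> (nat \<Rightarrow> int) \<Rightarrow> int \<Rightarrow> int \<times> int" where
  "special_pair q k a \<sigma> =
     (THE sm. fst sm \<in> {0..\<bar>q\<bar> - 1} \<and> kappa q k a (fst sm) (snd sm) = real_of_int \<sigma> / real_of_int q)"


text \<open>Explicit form of the integer powers of \<open>T\<close>, and well-definedness of \<open>special_pair\<close>.\<close>

lemma mat2_nth [simp]:
  "mat2 a b c d $ 1 $ 1 = a" "mat2 a b c d $ 1 $ 2 = b"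
  "mat2 a b c d $ 2 $ 1 = c" "mat2 a b c d $ 2 $ 2 = d"
  by (simp_all add: mat2_def)

lemma mat2_eq_iff:
  "(A :: int ^ 2 ^ 2) = B \<longleftrightarrow> A $ 1 $ 1 = B $ 1 $ 1 \<and> A $ 1 $ 2 = B $ 1 $ 2 \<and> A $ 2 $ 1 = B $ 2 $ 1 \<and> A $ 2 $ 2 = B $ 2 $ 2"
  by (auto simp: vec_eq_iff forall_2)

lemma mult2_nth:
  "((A :: int ^ 2 ^ 2) ** B) $ i $ j = A $ i $ 1 * B $ 1 $ j + A $ i $ 2 * B $ 2 $ j"
  by (simp add: matrix_matrix_mult_def sum_2)

lemma mat_1_eq: "(mat 1 :: int ^ 2 ^ 2) = mat2 1 0 0 1"
  by (simp add: mat2_eq_iff mat_def)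

lemma matrix_inv_T_mat: "matrix_inv T_mat = mat2 1 (-1) 0 1"
proof -
  let ?B = "mat2 1 (-1) 0 1"
  have B: "T_mat ** ?B = mat 1 \<and> ?B ** T_mat = mat 1"
    by (simp add: mat_1_eq T_mat_def mat2_eq_iff mult2_nth)
  hence inv: "T_mat ** matrix_inv T_mat = mat 1 \<and> matrix_inv T_mat ** T_mat = mat 1"
    unfolding matrix_inv_def by (rule someI)
  have "matrix_inv T_mat = (?B ** T_mat) ** matrix_inv T_mat"
    using B by simp
  also have "\<dots> = ?B"
    using inv by (simp add: matrix_mul_assoc [symmetric])
  finally show ?thesis .
qed

lemma T_zpow_eq: "T_zpow n = mat2 1 n 0 1"
proof -
  have "(((**) (mat2 1 e 0 1)) ^^ i) (mat 1) = mat2 1 (int i * e) 0 1" for e i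
    by (induction i) (auto simp: mat_1_eq mat2_eq_iff mult2_nth algebra_simps)
  thus ?thesis
    by (simp add: T_zpow_def matrix_inv_T_mat) (simp add: T_mat_def)
qed

lemma TS_word_row2:
  "TS_word a 0 $ 2 $ 1 = 0" "TS_word a 0 $ 2 $ 2 = 1"
  "TS_word a (Suc 0) $ 2 $ 1 = 1" "TS_word a (Suc 0) $ 2 $ 2 = 0"
  "TS_word a (Suc (Suc j)) $ 2 $ i = a (Suc j) * TS_word a (Suc j) $ 2 $ i - TS_word a j $ 2 $ i"
  by (simp_all add: mat_1_eq T_zpow_eq S_mat_def mult2_nth algebra_simps)

lemma TS_word_det:
  "TS_word a (Suc j) $ 2 $ 1 * TS_word a j $ 2 $ 2 - TS_word a (Suc j) $ 2 $ 2 * TS_word a j $ 2 $ 1 = 1"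
proof (induction j)
  case 0
  show ?case by (simp only: TS_word_row2)
next
  case (Suc j)
  thus ?case by (simp only: TS_word_row2) (simp add: algebra_simps)
qed

lemma C_entry_sum_parity:
  "even ((\<Sum>h = 1..j. a h * C_entry a h) + 1 + C_entry a j + C_entry a (Suc j))"
proof (induction j)
  case 0
  show ?case unfolding C_entry_def by (simp only: TS_word_row2) simp
next
  case (Suc j)
  have "C_entry a (Suc (Suc j)) = a (Suc j) * C_entry a (Suc j) - C_entry a j"
    unfolding C_entry_def by (simp only: TS_word_row2)
  moreover have "(\<Sum>h = 1..Suc j. a h * C_entry a h)
      = (\<Sum>h = 1..j. a h * C_entry a h) + a (Suc j) * C_entry a (Suc j)"
    by simp
  ultimately have "(\<Sum>h = 1..Suc j. a h * C_entry a h) + 1 + C_entry a (Suc j) + C_entry a (Suc (Suc j))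
      = ((\<Sum>h = 1..j. a h * C_entry a h) + 1 + C_entry a j + C_entry a (Suc j)) + 2 * (C_entry a (Suc (Suc j)))"
    by linarith
  moreover have "even \<dots>" by (rule dvd_add [OF Suc.IH dvd_triv_left])
  ultimately show ?case by argo
qed

lemma I_fun_eq_of_int:
  assumes "\<forall>j\<in>{1..k}. C_entry a j \<noteq> 0" "1 \<le> k"
  shows "I_fun k a s =
    of_int (- (C_entry a (k - 1) * (2 * s + 1)) - (-1) ^ k * (\<Sum>h = 1..k - 1. a h * C_entry a h))"
proof (cases "k = 1")
  case True
  thus ?thesis by (simp add: I_fun_def C_entry_def mat_1_eq)
next
  case False
  then obtain j where k: "k = Suc j" "j \<ge> 1" using assms(2) by (cases k) auto
  hence "C_entry a j \<noteq> 0" using assms by auto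
  thus ?thesis by (simp add: k I_fun_def K_entry_def field_simps)
qed

lemma special_pair_ex1:
  assumes "q \<noteq> 0" "1 \<le> k" "C_entry a k = q" "\<forall>j\<in>{1..k}. C_entry a j \<noteq> 0" "odd \<sigma>"
  shows "\<exists>!sm. fst sm \<in> {0..\<bar>q\<bar> - 1} \<and>
           kappa q k a (fst sm) (snd sm) = real_of_int \<sigma> / real_of_int q"
proof -
  define C where "C = C_entry a (k - 1)"
  define \<Sigma> where "\<Sigma> = (\<Sum>h = 1..k - 1. a h * C_entry a h)"
  define D where "D = TS_word a (k - 1) $ 2 $ 2"
  define D' where "D' = TS_word a k $ 2 $ 2"
  have Suc_k: "Suc (k - 1) = k" using assms(2) by simp
  have det: "q * D - D' * C = 1"
    using TS_word_det [of a "k - 1"] unfolding Suc_k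
    by (simp add: C_def D_def D'_def C_entry_def assms(3) [symmetric])
  have "even (\<Sigma> + 1 + C + q)"
    using C_entry_sum_parity [of a "k - 1"] unfolding Suc_k by (simp add: C_def \<Sigma>_def assms(3))
  hence "even (- C - (-1) ^ k * \<Sigma> + q - \<sigma>)"
    using assms(5) by auto
  then obtain M where M: "- C - (-1) ^ k * \<Sigma> + q - \<sigma> = 2 * M" by (elim evenE)
  have iff: "kappa q k a s m = of_int \<sigma> / of_int q \<longleftrightarrow> C * s + q * m = M" for s m
  proof -
    have "kappa q k a s m = of_int \<sigma> / of_int q \<longleftrightarrow>
      (of_int (- (C * (2 * s + 1)) - (-1) ^ k * \<Sigma> + q - 2 * q * m) :: real) = of_int \<sigma>"
      using assms(1) unfolding kappa_def I_fun_eq_of_int [OF assms(4,2)] C_def [symmetric] \<Sigma>_def [symmetric]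
      by (simp add: field_simps)
    also have "\<dots> \<longleftrightarrow> - (C * (2 * s + 1)) - (-1) ^ k * \<Sigma> + q - 2 * q * m = \<sigma>"
      by (rule of_int_eq_iff)
    also have "\<dots> \<longleftrightarrow> C * s + q * m = M"
      using M by (auto simp: algebra_simps)
    finally show ?thesis .
  qed
  define s where "s = (- D' * M) mod \<bar>q\<bar>"
  have s: "s \<in> {0..\<bar>q\<bar> - 1}"
    using assms(1) by (simp add: s_def)
  have "q dvd (- D' * M) - s"
    unfolding s_def by (metis abs_dvd_iff dvd_minus_mod)
  then obtain t where t: "- D' * M - s = q * t" by (elim dvdE)
  have sol: "C * s + q * (D * M + C * t) = M"
  proof -
    have "C * s + q * (D * M + C * t) = C * (s + q * t) + q * D * M"
      by (simp add: algebra_simps)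
    also have "\<dots> = (q * D - D' * C) * M"
      by (simp add: t [symmetric] algebra_simps)
    finally show ?thesis by (simp add: det)
  qed
  show ?thesis
  proof (rule ex1I [of _ "(s, D * M + C * t)"])
    show "fst (s, D * M + C * t) \<in> {0..\<bar>q\<bar> - 1} \<and>
      kappa q k a (fst (s, D * M + C * t)) (snd (s, D * M + C * t)) = real_of_int \<sigma> / real_of_int q"
      using s sol iff by simp
  next
    fix sm assume sm: "fst sm \<in> {0..\<bar>q\<bar> - 1} \<and>
      kappa q k a (fst sm) (snd sm) = real_of_int \<sigma> / real_of_int q"
    have eq: "C * fst sm + q * snd sm = M" using sm iff by blast
    have diff: "C * (fst sm - s) = q * (D * M + C * t - snd sm)"
      using eq sol by (simp add: algebra_simps)
    have "fst sm - s = (q * D - D' * C) * (fst sm - s)" by (simp add: det)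
    also have "\<dots> = q * (D * (fst sm - s)) - D' * (C * (fst sm - s))" by (simp add: algebra_simps)
    also have "\<dots> = q * (D * (fst sm - s) - D' * (D * M + C * t - snd sm))"
      unfolding diff by (simp add: algebra_simps)
    finally have "q dvd fst sm - s" by (rule dvdI)
    moreover have "\<bar>fst sm - s\<bar> < \<bar>q\<bar>" using s sm by auto
    ultimately have "fst sm = s" using dvd_imp_le_int [of "fst sm - s" q] by linarith
    moreover from this have "snd sm = D * M + C * t" using diff assms(1) by simp
    ultimately show "sm = (s, D * M + C * t)" by (simp add: prod_eq_iff)
  qed
qed


section \<open>The quantum dilogarithm\<close>

definition qdilog_integrand :: "nat \<Rightarrow> complex \<Rightarrow> complex \<Rightarrow> complex" where
  "qdilog_integrand r z x =
     exp ((2 * z - of_real pi) * x)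
       / (4 * x * sinh (of_real pi * x) * sinh (2 * of_real pi * x / of_nat r))"

text \<open>The contour runs along \<open>(-\<infinity>, -\<eta>]\<close>, the upper half circle of radius \<open>\<eta>\<close> from \<open>-\<eta>\<close> to \<open>\<eta>\<close>
  (argument decreasing from \<open>\<pi>\<close> to \<open>0\<close>), and \<open>[\<eta>, \<infinity>)\<close>. The value is meaningful for
  \<open>-\<pi>/r < Re z < \<pi> + \<pi>/r\<close>, where the integrals over the two rays converge absolutely.\<close>

definition Omega_integral :: "real \<Rightarrow> (complex \<Rightarrow> complex) \<Rightarrow> complex" where
  "Omega_integral \<eta> g =
     (LINT x:{..-\<eta>}|lborel. g (of_real x))
     + contour_integral (part_circlepath 0 \<eta> pi 0) g
     + (LINT x:{\<eta>..}|lborel. g (of_real x))"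

definition qdilog :: "real \<Rightarrow> nat \<Rightarrow> complex \<Rightarrow> complex" where
  "qdilog \<eta> r z =
     4 * of_real pi * \<i> / of_nat r * Omega_integral \<eta> (qdilog_integrand r z)"


section \<open>The region and the bump function\<close>

definition D_region :: "real \<Rightarrow> (real \<times> real \<times> real) set" where
  "D_region \<epsilon> = {(x, y, z).
     \<bar>x\<bar> < pi / 4 - \<epsilon> \<and> y - x > \<epsilon> \<and> x + y > \<epsilon> \<and> z - y > \<epsilon> \<and> y + z < pi - \<epsilon> \<and>
     y + 2 * z < 7 / 4 * pi - \<epsilon> \<and> 2 * z - y > pi / 4 + \<epsilon>}"

text \<open>\<open>Ck_fun n f\<close>: all iterated directional derivatives of order at most \<open>n\<close> exist (as Frechet
  derivatives) and are continuous.\<close>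

primrec Ck_fun :: "nat \<Rightarrow> ('a::euclidean_space \<Rightarrow> real) \<Rightarrow> bool" where
  "Ck_fun 0 f \<longleftrightarrow> continuous_on UNIV f"
| "Ck_fun (Suc n) f \<longleftrightarrow>
     (\<forall>x. f differentiable at x) \<and> (\<forall>v. Ck_fun n (\<lambda>x. frechet_derivative f (at x) v))"

definition Cinf_fun :: "('a::euclidean_space \<Rightarrow> real) \<Rightarrow> bool" where
  "Cinf_fun f \<longleftrightarrow> (\<forall>n. Ck_fun n f)"

definition bump :: "real \<Rightarrow> (real \<times> real \<times> real \<Rightarrow> real) \<Rightarrow> bool" where
  "bump \<epsilon> \<psi> \<longleftrightarrow>
     Cinf_fun \<psi> \<and>
     (\<forall>w \<in> closure (D_region \<epsilon>). \<psi> w = 1) \<and>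
     (\<forall>w \<in> D_region (\<epsilon> / 2) - closure (D_region \<epsilon>). 0 < \<psi> w \<and> \<psi> w < 1) \<and>
     (\<forall>w. w \<notin> D_region (\<epsilon> / 2) \<longrightarrow> \<psi> w = 0) \<and>
     (\<forall>x y z. \<psi> (x, y, z) = \<psi> (- x, y, z) \<and> \<psi> (x, y, z) = \<psi> (x, y, pi - z))"


section \<open>The potential function and the Fourier coefficients\<close>

text \<open>On \<open>D_region 0\<close> all arguments of the quantum dilogarithm lie in the strip where it is defined.\<close>

definition V_pot ::
  "int \<Rightarrow> int \<Rightarrow> int \<Rightarrow> nat \<Rightarrow> (nat \<Rightarrow> int) \<Rightarrow> real \<Rightarrow> nat \<Rightarrow>
   real \<Rightarrow> real \<Rightarrow> real \<Rightarrow> int \<Rightarrow> int \<Rightarrow> int \<Rightarrow> int \<Rightarrow> complex" where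
  "V_pot p q p' k a \<eta> r x y z s m n l =
     qdilog \<eta> r (of_real (y + x + pi / r)) + qdilog \<eta> r (of_real (y - x + pi / r))
     + qdilog \<eta> r (of_real (z - y)) + qdilog \<eta> r (of_real (pi - y - z))
     - qdilog \<eta> r (of_real (pi - y - pi / r)) - qdilog \<eta> r (of_real (pi / r))
     + of_real (- ((p + 2 * q) / q) * x\<^sup>2 - 4 * y\<^sup>2 - (4 * p' + 2) * z\<^sup>2
         + 2 * pi * kappa q k a s m * x - 4 * pi * n * y - 2 * pi * (2 * l + 1) * z
         + K_fun q k a s * pi\<^sup>2 - pi\<^sup>2 / 3 - 4 * pi / r * (x + y)
         + 2 * pi\<^sup>2 / r - pi\<^sup>2 / (3 * r\<^sup>2))"

definition fourier_coeff ::
  "int \<Rightarrow> int \<Rightarrow> int \<Rightarrow> nat \<Rightarrow> (nat \<Rightarrow> int) \<Rightarrow> real \<Rightarrow> real \<Rightarrow> (real \<times> real \<times> real \<Rightarrow> real) \<Rightarrow> nat \<Rightarrow>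
   int \<Rightarrow> int \<Rightarrow> int \<Rightarrow> int \<Rightarrow> complex" where
  "fourier_coeff p q p' k a \<eta> \<epsilon> \<psi> r s m n l =
     4 * (-1) powi (m + n + l) * of_real ((r / (2 * pi)) ^ 3) *
     (LINT (x, y, z):D_region (\<epsilon> / 2)|lborel.
        of_real (\<psi> (x, y, z) * sin (x / q - J_fun q k a s * pi) * sin (2 * z)) *
        exp (- \<i> * of_real (x + y)
             + of_nat r / (4 * of_real pi * \<i>) * V_pot p q p' k a \<eta> r x y z s m n l))"

end

theory Submission
  imports Defs
begin

text \<open>The reflection \<open>x \<mapsto> - x\<close> preserves the region, the bump function and the sum of quantum
  dilogarithms, and exchanges \<open>\<kappa>(s, m)\<close> with \<open>\<kappa>(s', m') = - \<kappa>(s, m)\<close>. What remains is to compare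
  constants: with \<open>M = m + m' - 1\<close> one finds \<open>K(s) - K(s') = - 4 M (s - s')\<close>, Abel summation shows
  that \<open>J(s) + J(s')\<close> is an even integer, and the signs cancel because \<open>M (s + s' + 1)\<close> is even.\<close>

text \<open>Since \<open>T\<close> is its own inverse, \<open>f\<close> composed with
  \<open>T\<close> is measurable exactly when \<open>f\<close> is; otherwise both Bochner integrals
  take the default value 0. So no measurability of the quantum dilogarithm has to be
  established.\<close>

lemma integral_involution:
  fixes f :: "'a \<Rightarrow> 'b::{banach, second_countable_topology}"
  assumes T: "T \<in> measurable M M" and pres: "distr M M T = M" and inv: "\<And>x. T (T x) = x"
  shows "(LINT x|M. f (T x)) = (LINT x|M. f x)"
proof (cases "f \<in> borel_measurable M")
  case True
  have "(LINT x|M. f x) = (LINT x|distr M M T. f x)"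
    by (simp add: pres)
  also have "\<dots> = (LINT x|M. f (T x))"
    using T True by (rule integral_distr)
  finally show ?thesis ..
next
  case False
  have "(\<lambda>x. f (T x)) \<notin> borel_measurable M"
  proof
    assume "(\<lambda>x. f (T x)) \<in> borel_measurable M"
    from measurable_compose [OF T this] show False
      using False by (simp add: inv)
  qed
  with False show ?thesis
    by (metis borel_measurable_integrable not_integrable_integral_eq)
qed

text \<open>Factoring \<open>lborel\<close> as a product measure reduces this to the invariance of
  Lebesgue measure on the line under negation.\<close>

lemma distr_lborel_reflect_fst:
  "distr lborel lborel (\<lambda>(x, w). (- x, w)) = (lborel :: (real \<times> 'a::euclidean_space) measure)"
proof -
  have id: "distr lborel lborel (\<lambda>w :: 'a. w) = lborel"
    by (rule distr_id)
  have "distr lborel lborel (uminus :: real \<Rightarrow> real) = distr lborel borel uminus"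
    by (rule distr_cong) simp_all
  also have "\<dots> = lborel"
    by (rule lborel_distr_uminus)
  finally have neg: "distr lborel lborel (uminus :: real \<Rightarrow> real) = lborel" .
  have "distr lborel lborel uminus \<Otimes>\<^sub>M distr lborel lborel (\<lambda>w :: 'a. w) =
      distr (lborel \<Otimes>\<^sub>M lborel) (lborel \<Otimes>\<^sub>M lborel) (\<lambda>(x :: real, w). (- x, w))"
    by (rule pair_measure_distr) (simp_all add: id sigma_finite_lborel)
  then show ?thesis
    unfolding neg id by (simp only: lborel_prod)
qed

lemma lborel_integral_reflect_fst:
  fixes f :: "real \<times> 'a::euclidean_space \<Rightarrow> 'b::{banach, second_countable_topology}"
  shows "(LINT w|lborel. f (- fst w, snd w)) = (LINT w|lborel. f w)"
proof -
  have "(\<lambda>(x, w). (- x, w)) \<in> measurable lborel (lborel :: (real \<times> 'a) measure)"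
    unfolding lborel_prod [symmetric] by measurable
  from integral_involution [OF this distr_lborel_reflect_fst, of f] show ?thesis
    by (simp add: case_prod_beta)
qed

text \<open>Let (C_j, d_j) be the lower row of \<open>TS_word a j\<close> and S_j the partial sum of
  a_h C_h. The summand is S_j / (C_j C_{j+1}), and the determinant relation gives 1 / (C_j C_{j+1})
  = d_j / C_j - d_{j+1} / C_{j+1}. Abel summation leaves the integers a_j d_j and one boundary
  term.\<close>

lemma J_sum_eq:
  assumes "\<forall>j\<in>{1..Suc k}. C_entry a j \<noteq> 0"
  shows "(\<Sum>j = 1..k. (-1) ^ (j + 1) * K_entry a j / real_of_int (C_entry a (j + 1))) =
    of_int (\<Sum>j = 1..k. a j * TS_word a j $ 2 $ 2)
    - of_int ((\<Sum>h = 1..k. a h * C_entry a h) * TS_word a (Suc k) $ 2 $ 2) / of_int (C_entry a (Suc k))"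
  using assms
proof (induction k)
  case 0
  show ?case by simp
next
  case (Suc k)
  define S where "S = (\<Sum>h = 1..k. a h * C_entry a h)"
  define C where "C = C_entry a (Suc k)"
  define C' where "C' = C_entry a (Suc (Suc k))"
  define d where "d = TS_word a (Suc k) $ 2 $ 2"
  define d' where "d' = TS_word a (Suc (Suc k)) $ 2 $ 2"
  have nz: "C \<noteq> 0" "C' \<noteq> 0"
    using Suc.prems by (auto simp: C_def C'_def)
  have det: "C' * d - d' * C = 1"
    using TS_word_det [of a "Suc k"] by (simp only: C_def C'_def d_def d'_def C_entry_def)
  have K: "(-1) ^ (Suc k + 1) * K_entry a (Suc k) = real_of_int (S + a (Suc k) * C) / real_of_int C"
    by (simp add: K_entry_def S_def C_def)
  \<comment> \<open>The numerator is multiplied by the determinant, which is 1, to split the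
    fraction.\<close>
  have "of_int (S + a (Suc k) * C) / real_of_int C / real_of_int C' =
      of_int ((S + a (Suc k) * C) * (C' * d - d' * C)) / real_of_int C / real_of_int C'"
    by (simp add: det)
  also have "\<dots> = of_int (a (Suc k) * d) - of_int ((S + a (Suc k) * C) * d') / of_int C'
      + of_int (S * d) / of_int C"
    using nz by (simp add: field_simps)
  finally have step: "of_int (S + a (Suc k) * C) / real_of_int C / real_of_int C' = \<dots>" .
  have IH: "(\<Sum>j = 1..k. (-1) ^ (j + 1) * K_entry a j / real_of_int (C_entry a (j + 1))) =
      of_int (\<Sum>j = 1..k. a j * TS_word a j $ 2 $ 2) - of_int (S * d) / of_int C"
    using Suc.IH Suc.prems by (simp add: S_def C_def d_def)
  have sums: "(\<Sum>h = 1..Suc k. a h * C_entry a h) = S + a (Suc k) * C"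
    "(\<Sum>j = 1..Suc k. a j * TS_word a j $ 2 $ 2) = (\<Sum>j = 1..k. a j * TS_word a j $ 2 $ 2) + a (Suc k) * d"
    by (simp_all add: S_def C_def d_def)
  have "(\<Sum>j = 1..Suc k. (-1) ^ (j + 1) * K_entry a j / real_of_int (C_entry a (j + 1))) =
      (\<Sum>j = 1..k. (-1) ^ (j + 1) * K_entry a j / real_of_int (C_entry a (j + 1)))
      + (-1) ^ (Suc k + 1) * K_entry a (Suc k) / real_of_int C'"
    by (simp add: C'_def)
  also have "\<dots> = of_int (\<Sum>j = 1..Suc k. a j * TS_word a j $ 2 $ 2)
      - of_int ((\<Sum>h = 1..Suc k. a h * C_entry a h) * d') / of_int C'"
    unfolding IH K step sums by simp
  finally show ?case by (simp only: d'_def C'_def)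
qed

text \<open>Multiplied by q, the hypothesis reads I(s) + I(s') = 2 q M, and all three claims follow
  from it. They control, in order, the constant phase, the sine factor and the overall sign under
  the reflection.\<close>

lemma opposite_kappa_identities:
  assumes q: "q \<noteq> 0" and k: "1 \<le> k" and Ck: "C_entry a k = q" and nz: "\<forall>j\<in>{1..k}. C_entry a j \<noteq> 0"
    and opp: "kappa q k a s m + kappa q k a s' m' = 0"
  shows "K_fun q k a s = K_fun q k a s' - 4 * of_int ((m + m' - 1) * (s - s'))"
    and "\<exists>L :: int. J_fun q k a s + J_fun q k a s' = 2 * of_int L"
    and "even ((m + m' - 1) * (s + s' + 1))"
proof -
  define C where "C = C_entry a (k - 1)"
  define \<Sigma> where "\<Sigma> = (\<Sum>h = 1..k - 1. a h * C_entry a h)"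
  define D where "D = TS_word a (k - 1) $ 2 $ 2"
  define D' where "D' = TS_word a k $ 2 $ 2"
  define M where "M = m + m' - 1"
  define u where "u = s + s' + 1"
  have Suc_k: "Suc (k - 1) = k" using k by simp
  have det: "q * D - D' * C = 1"
    using TS_word_det [of a "k - 1"] unfolding Suc_k
    by (simp add: C_def D_def D'_def C_entry_def Ck [symmetric])
  have par: "even (\<Sigma> + 1 + C + q)"
    using C_entry_sum_parity [of a "k - 1"] unfolding Suc_k by (simp add: C_def \<Sigma>_def Ck)
  have I_sum: "I_fun k a s + I_fun k a s' = 2 * real_of_int (q * M)"
  proof -
    have "I_fun k a s / real_of_int q + I_fun k a s' / real_of_int q = 2 * real_of_int M"
      using opp by (simp add: kappa_def M_def)
    with q show ?thesis by (simp add: field_simps)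
  qed
  \<comment> \<open>The values of \<open>I_fun\<close> are integers, so the relation can be used
    modulo 2 and modulo q.\<close>
  have "real_of_int (- (C * (2 * u)) - 2 * (-1) ^ k * \<Sigma>) = real_of_int (2 * (q * M))"
    using I_sum unfolding I_fun_eq_of_int [OF nz k] C_def [symmetric] \<Sigma>_def [symmetric]
    by (simp add: u_def algebra_simps)
  hence rel: "- (C * u) - (-1) ^ k * \<Sigma> = q * M"
    unfolding of_int_eq_iff by (simp add: algebra_simps)
  show "even ((m + m' - 1) * (s + s' + 1))"
    unfolding M_def [symmetric] u_def [symmetric]
  proof (rule ccontr)
    assume "odd (M * u)"
    hence odd: "odd M" "odd u" by auto
    \<comment> \<open>For odd \<open>M\<close> and \<open>u\<close> this makes C + \<Sigma> + q
      even, whereas \<open>par\<close> makes it odd.\<close>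
    have "even (- (C * u) - (-1) ^ k * \<Sigma> - q * M)" by (simp add: rel)
    with odd par show False by auto
  qed
  have rel_real: "- real_of_int C * (2 * real_of_int u + 2 * K_entry a (k - 1)) = 2 * real_of_int (q * M)"
    using I_sum by (simp add: I_fun_def C_def u_def algebra_simps)
  \<comment> \<open>The sums over j cancel; the rest is a difference of two squares.\<close>
  have "K_fun q k a s - K_fun q k a s' =
      real_of_int C * (2 * real_of_int u + 2 * K_entry a (k - 1)) * (2 * real_of_int (s - s')) / real_of_int q"
    unfolding K_fun_def C_def [symmetric] using q by (simp add: u_def field_simps power2_eq_square)
  also have "real_of_int C * (2 * real_of_int u + 2 * K_entry a (k - 1)) = - 2 * real_of_int (q * M)"
    using rel_real by simp
  also have "- 2 * real_of_int (q * M) * (2 * real_of_int (s - s')) / real_of_int q = - 4 * of_int (M * (s - s'))"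
    using q by simp
  finally show "K_fun q k a s = K_fun q k a s' - 4 * of_int ((m + m' - 1) * (s - s'))"
    by (simp add: M_def)
  define A where "A = (\<Sum>j = 1..k - 1. a j * TS_word a j $ 2 $ 2)"
  have J_sum: "(\<Sum>j = 1..k - 1. (-1) ^ (j + 1) * K_entry a j / real_of_int (C_entry a (j + 1))) =
      of_int A - of_int (\<Sigma> * D') / of_int q"
    using J_sum_eq [of "k - 1" a] nz unfolding Suc_k Ck A_def \<Sigma>_def D'_def by simp
  \<comment> \<open>This is the numerator over q of half the non-integral part of J(s) + J(s').
    Multiplying \<open>u\<close> by the determinant 1 lets \<open>rel\<close> show that q divides
    it.\<close>
  have "u - (-1) ^ k * \<Sigma> * D' = u * (q * D - D' * C) - (-1) ^ k * \<Sigma> * D'"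
    by (simp add: det)
  also have "\<dots> = q * D * u + (- (C * u) - (-1) ^ k * \<Sigma>) * D'"
    by (simp add: algebra_simps)
  also have "\<dots> = q * (D * u + M * D')"
    unfolding rel by (simp add: algebra_simps)
  finally have "real_of_int (u - (-1) ^ k * \<Sigma> * D') = real_of_int (q * (D * u + M * D'))"
    by simp
  hence div: "(real_of_int u - (-1) ^ k * of_int (\<Sigma> * D')) / real_of_int q = of_int (D * u + M * D')"
    using q by (simp add: field_simps)
  have "J_fun q k a s + J_fun q k a s' =
      2 * ((real_of_int u - (-1) ^ k * of_int (\<Sigma> * D')) / real_of_int q) + 2 * (-1) ^ k * of_int A"
    unfolding J_fun_def J_sum by (simp add: u_def add_divide_distrib diff_divide_distrib algebra_simps)
  also have "\<dots> = 2 * of_int (D * u + M * D' + (-1) ^ k * A)"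
    unfolding div by simp
  finally show "\<exists>L :: int. J_fun q k a s + J_fun q k a s' = 2 * of_int L" ..
qed

lemma D_region_reflect: "(- x, y, z) \<in> D_region \<epsilon> \<longleftrightarrow> (x, y, z) \<in> D_region \<epsilon>"
  by (auto simp: D_region_def)

lemma exp_i_pi_of_int: "exp (\<i> * of_real (pi * of_int N)) = (-1) powi N"
proof (cases "even N")
  case True
  then obtain c where "N = 2 * c" by (elim evenE)
  then show ?thesis
    using exp_integer_2pi [of "of_int c"] by (simp add: mult_ac power_int_minus_left)
next
  case False
  then obtain c where N: "N = 2 * c + 1" by (elim oddE)
  have "exp (\<i> * of_real (pi * of_int N)) = exp ((2 * of_int c * pi) * \<i>) * exp (\<i> * pi)"
    unfolding N exp_add [symmetric] by (simp add: algebra_simps)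
  with False show ?thesis
    by (simp add: exp_integer_2pi power_int_minus_left mult_ac)
qed

text \<open>The linear term \<open>- 4 \<pi> (x + y) / r\<close> of the potential cancels \<open>- \<i> (x + y)\<close>, which is what makes
  the exponent symmetric under the reflection.\<close>

lemma exponent_reflect:
  assumes r: "r > 0" and opp: "kappa q k a s m + kappa q k a s' m' = 0"
    and K: "K_fun q k a s = K_fun q k a s' - 4 * of_int N"
  shows "- \<i> * of_real (x + y) + of_nat r / (4 * of_real pi * \<i>) * V_pot p q p' k a \<eta> r x y z s m n l =
    - \<i> * of_real (- x + y) + of_nat r / (4 * of_real pi * \<i>) * V_pot p q p' k a \<eta> r (- x) y z s' m' n l
    + \<i> * of_real (pi * of_int (int r * N))"
proof -
  have kappa': "kappa q k a s' m' = - kappa q k a s m" using opp by simp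
  \<comment> \<open>The dilogarithms at y + x and y - x swap, and the linear term in kappa is even
    because kappa changes sign too. After the factor r / (4 pi i), the two remaining terms become i
    pi r N and 2 i x.\<close>
  have "V_pot p q p' k a \<eta> r x y z s m n l =
      V_pot p q p' k a \<eta> r (- x) y z s' m' n l - of_real (4 * of_int N * pi\<^sup>2 + 8 * pi / r * x)"
    unfolding V_pot_def kappa' K by (simp add: algebra_simps add_divide_distrib diff_divide_distrib)
  then show ?thesis
    using r by (simp add: field_simps power2_eq_square)
qed

lemma fourier_coeff_eq_if_opposite:
  assumes q: "q \<noteq> 0" and k: "1 \<le> k" and Ck: "C_entry a k = q" and nz: "\<forall>j\<in>{1..k}. C_entry a j \<noteq> 0"
    and r: "odd r" and \<psi>: "\<And>x y z. \<psi> (- x, y, z) = \<psi> (x, y, z)"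
    and opp: "kappa q k a s m + kappa q k a s' m' = 0"
  shows "fourier_coeff p q p' k a \<eta> \<epsilon> \<psi> r s m n l = fourier_coeff p q p' k a \<eta> \<epsilon> \<psi> r s' m' n l"
proof -
  define N where "N = (m + m' - 1) * (s - s')"
  note ids = opposite_kappa_identities [OF q k Ck nz opp]
  obtain L :: int where L: "J_fun q k a s + J_fun q k a s' = 2 * of_int L" using ids(2) by blast
  define F where "F s m = (\<lambda>(x, y, z). of_real (\<psi> (x, y, z) * sin (x / q - J_fun q k a s * pi) * sin (2 * z)) *
        exp (- \<i> * of_real (x + y)
             + of_nat r / (4 * of_real pi * \<i>) * V_pot p q p' k a \<eta> r x y z s m n l))" for s m
  define G where "G s m = (\<lambda>w. indicator (D_region (\<epsilon> / 2)) w *\<^sub>R F s m w)" for s m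
  \<comment> \<open>The sign depending on \<open>m\<close> goes under the integral, so that the two
    integrands can be compared pointwise.\<close>
  have fc: "fourier_coeff p q p' k a \<eta> \<epsilon> \<psi> r s m n l =
      4 * of_real ((r / (2 * pi)) ^ 3) * (LINT w|lborel. (-1) powi (m + n + l) * G s m w)" for s m
    unfolding integral_mult_right_zero fourier_coeff_def G_def F_def set_lebesgue_integral_def by (simp add: mult_ac)
  have sin_eq: "sin (x / q - J_fun q k a s * pi) = - sin (- x / q - J_fun q k a s' * pi)" for x
  proof -
    have *: "x / q - J_fun q k a s * pi = - (- x / q - J_fun q k a s' * pi) - 2 * pi * of_int L"
      using arg_cong [OF L, of "\<lambda>t. t * pi"] by (simp add: algebra_simps)
    have "sin (- t - 2 * pi * of_int L) = - sin t" for t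
      by (simp add: sin_diff sin_int_2pin cos_int_2pin)
    then show ?thesis
      unfolding * .
  qed
  \<comment> \<open>Modulo 2, r N is N and m - m' + 1 is M = m + m' - 1, so the total is M (s + s' +
    1), which is even.\<close>
  have "even ((m + n + l) + 1 + int r * N - (m' + n + l))"
    using ids(3) r by (auto simp: N_def)
  hence sign: "- ((-1) powi (m + n + l) * (-1) powi (int r * N)) = ((-1) powi (m' + n + l) :: complex)"
    by (auto simp: power_int_minus_left split: if_splits)
  have "(-1) powi (m + n + l) * G s m w = (-1) powi (m' + n + l) * G s' m' (- fst w, snd w)" for w
  proof (cases w)
    case (fields x y z)
    have "(-1) powi (m + n + l) * F s m (x, y, z) =
        - ((-1) powi (m + n + l) * (-1) powi (int r * N)) * F s' m' (- x, y, z)"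
      unfolding F_def prod.case exponent_reflect [OF odd_pos [OF r] opp ids(1) [folded N_def]] exp_add
        exp_i_pi_of_int sin_eq \<psi> by simp
    with sign show ?thesis
      by (simp add: G_def fields D_region_reflect indicator_def)
  qed
  hence "(LINT w|lborel. (-1) powi (m + n + l) * G s m w) =
      (LINT w|lborel. (-1) powi (m' + n + l) * G s' m' (- fst w, snd w))"
    by simp
  also have "\<dots> = (LINT w|lborel. (-1) powi (m' + n + l) * G s' m' w)"
    by (rule lborel_integral_reflect_fst)
  finally show ?thesis
    unfolding fc by simp
qed

theorem proposition4p4:
  fixes p q p_tilde q_tilde p' :: int
    and k r :: nat
    and a :: "nat \<Rightarrow> int"
    and \<eta> \<epsilon> :: real
    and \<psi> :: "real \<times> real \<times> real \<Rightarrow> real"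
  assumes "coprime p q" and "q \<noteq> 0"
    and "p * p_tilde + q * q_tilde = 1"
    and "1 \<le> k"
    and "mat2 p (- q_tilde) q p_tilde = TS_word a k"
    and "\<forall>j\<in>{1..k}. C_entry a j \<noteq> 0"
    and "3 \<le> r" and "odd r"
    and "0 < \<eta>" and "\<eta> < 1"
    and "0 < \<epsilon>" and "bump \<epsilon> \<psi>"
  shows "(\<forall>s\<in>{0..\<bar>q\<bar> - 1}. \<forall>s'\<in>{0..\<bar>q\<bar> - 1}. \<forall>m m' :: int.
            kappa q k a s m + kappa q k a s' m' = 0 \<longrightarrow>
            (\<forall>n l :: int. fourier_coeff p q p' k a \<eta> \<epsilon> \<psi> r s m n l
                        = fourier_coeff p q p' k a \<eta> \<epsilon> \<psi> r s' m' n l))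
       \<and> (let (sp, mp) = special_pair q k a 1; (sm, mm) = special_pair q k a (- 1) in
            \<forall>n l :: int. fourier_coeff p q p' k a \<eta> \<epsilon> \<psi> r sp mp n l
                       = fourier_coeff p q p' k a \<eta> \<epsilon> \<psi> r sm mm n l)"
proof -
  have Ck: "C_entry a k = q"
    using assms(5) [symmetric] by (simp add: C_entry_def)
  have \<psi>: "\<psi> (- x, y, z) = \<psi> (x, y, z)" for x y z
    using assms(12) unfolding bump_def by metis
  note coeff_eq = fourier_coeff_eq_if_opposite [where \<psi> = \<psi>, OF assms(2,4) Ck assms(6,8) \<psi>]
  \<comment> \<open>Only odd \<sigma> can occur: q times kappa is always an odd integer by
    \<open>C_entry_sum_parity\<close>.\<close>
  have special: "kappa q k a (fst (special_pair q k a \<sigma>)) (snd (special_pair q k a \<sigma>)) = of_int \<sigma> / of_int q"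
    if "odd \<sigma>" for \<sigma>
    using theI' [OF special_pair_ex1 [OF assms(2,4) Ck assms(6) that]]
    unfolding special_pair_def by blast
  have "kappa q k a (fst (special_pair q k a 1)) (snd (special_pair q k a 1))
      + kappa q k a (fst (special_pair q k a (- 1))) (snd (special_pair q k a (- 1))) = 0"
    by (simp add: special)
  from coeff_eq [OF this] show ?thesis
    by (auto simp: case_prod_beta intro: coeff_eq)
qed

end
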